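(* Let $A$ be an $m\times n$ matrix with entries in the extended tropical semiring $\mathbb{T}_{\mathrm e}$, with $m\geq n$. Then the columns of $A$ are tropically linearly independent if and only if $A$ has an $n\times n$ submatrix that is tropically nonsingular.
   Context: Let $\mathbb{N}_2=\{0,1,2\}$ be the semiring obtained as the quotient of $\mathbb{N}$ by identifying all integers $\geq2$. The extended tropical semiring is the set $\mathbb{T}_{\mathrm e}:=(\mathbb{N}_2\setminus\{0\})\times\mathbb{R}\ \cup\ \{(0,-\infty)\}$ with addition $(a,b)\oplus(a',b')=(a+a',b)$ if $b=b'$, $(a,b)$ if $b>b'$, $(a',b')$ if $b<b'$, and multiplication $(a,b)\odot(a',b')=(aa',b+b')$. Its zero is $\mathbb{0}=(0,-\infty)$ and its unit is $(1,0)$. Put $a^\circ=a\oplus a$, $\mathbb{T}_{\mathrm e}^\circ=\{a^\circ:a\in\mathbb{T}_{\mathrm e}\}$ (i.e. $\mathbb{0}$ and the elements $(2,b)$, $b\in\mathbb{R}$), and $\mathbb{T}_{\mathrm e}^\vee=(\mathbb{T}_{\mathrm e}\setminus\mathbb{T}_{\mathrm e}^\circ)\cup\{\mathbb{0}\}$ (i.e. $\mathbb{0}$ and the elements $(1,b)$, $b\in\mathbb{R}$). The invertible elements of $\mathbb{T}_{\mathrm e}$ are exactly those of $\mathbb{T}_{\mathrm e}^\vee\setminus\{\mathbb{0}\}$. The balance relation is $a\,\nabla\,b\iff a\oplus b\in\mathbb{T}_{\mathrm e}^\circ$, extended entrywise to vectors. The columns of an $m\times n$ matrix $A$ over $\mathbb{T}_{\mathrm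 e}$ are tropically linearly dependent if there exists a vector $x\in(\mathbb{T}_{\mathrm e}^\vee)^n$, different from the zero vector, such that $Ax\,\nabla\,\mathbb{0}$, where $(Ax)_i=\bigoplus_{j}A_{ij}\odot x_j$; otherwise they are tropically linearly independent. The permanent of an $n\times n$ matrix $F$ over $\mathbb{T}_{\mathrm e}$ is $\operatorname{per}F=\bigoplus_{\sigma}F_{1\sigma(1)}\odot\cdots\odot F_{n\sigma(n)}$ over all permutations $\sigma$ of $\{1,\dots,n\}$, and $F$ is tropically nonsingular if $\operatorname{per}F$ is invertible in $\mathbb{T}_{\mathrm e}$. *)

theory Defs
  imports "Jordan_Normal_Form.DL_Submatrix" "HOL-Library.Extended_Real"
    "HOL-Combinatorics.Permutations"
begin

quotient_type nat2 = nat / "\<lambda>a b. a = b \<or> (2 \<le> a \<and> 2 \<le> b)"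
  by (rule equivpI) (auto simp: reflp_def symp_def transp_def)

instantiation nat2 :: comm_semiring_1
begin

lift_definition zero_nat2 :: nat2 is 0 .
lift_definition one_nat2 :: nat2 is 1 .
lift_definition plus_nat2 :: "nat2 \<Rightarrow> nat2 \<Rightarrow> nat2" is "(+)" by auto

lift_definition times_nat2 :: "nat2 \<Rightarrow> nat2 \<Rightarrow> nat2" is "(*)"
proof -
  fix a b c d :: nat
  assume 1: "a = b \<or> 2 \<le> a \<and> 2 \<le> b" and 2: "c = d \<or> 2 \<le> c \<and> 2 \<le> d"
  have *: "2 \<le> x * y" if "2 \<le> x" "y \<noteq> 0" for x y :: nat
    using that mult_le_mono[of 2 x 1 y] by simp
  have **: "2 \<le> x * y" if "2 \<le> y" "x \<noteq> 0" for x y :: nat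
    using *[OF that] by (simp add: mult.commute)
  show "a * c = b * d \<or> 2 \<le> a * c \<and> 2 \<le> b * d"
  proof (cases "a = b")
    case True
    with 2 show ?thesis by (cases "a = 0") (auto intro!: **)
  next
    case False
    with 1 have "2 \<le> a" "2 \<le> b" by auto
    with 2 show ?thesis by (cases "c = 0") (auto intro!: *)
  qed
qed

instance
  by standard (transfer; auto simp: algebra_simps)+

end

lemma nat2_cases: "a = 0 \<or> a = 1 \<or> a = 2" for a :: nat2
  unfolding one_add_one [symmetric] by transfer auto

lemma nat2_distinct: "(0 :: nat2) \<noteq> 2" "(1 :: nat2) \<noteq> 2"
  unfolding one_add_one [symmetric] by (transfer; simp)+

lemma nat2_add_eq_0_iff: "a + b = 0 \<longleftrightarrow> a = 0 \<and> b = 0" for a b :: nat2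
  by transfer auto

lemma nat2_double: "a + a = (if a = 0 then 0 else 2)" for a :: nat2
  unfolding one_add_one [symmetric] by transfer auto

lemma nat2_mult_eq_1_iff: "a * b = 1 \<longleftrightarrow> a = 1 \<and> b = 1" for a b :: nat2
proof -
  have "(2 :: nat2) * 2 = 2"
    unfolding one_add_one [symmetric] by transfer simp
  then show ?thesis
    using nat2_cases[of a] nat2_cases[of b] nat2_distinct by auto
qed

lemma nat2_mult_eq_0_iff: "a * b = 0 \<longleftrightarrow> a = 0 \<or> b = 0" for a b :: nat2
  by transfer auto

text \<open>The condition \<open>\<bar>b\<bar> \<noteq> \<infinity>\<close> says that \<open>b\<close> is a real number.\<close>

typedef ext_trop =
  "{(a :: nat2, b :: ereal). a \<noteq> 0 \<and> \<bar>b\<bar> \<noteq> \<infinity> \<or> a = 0 \<and> b = - \<infinity>}"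
  by (rule exI[of _ "(0, - \<infinity>)"]) simp

setup_lifting type_definition_ext_trop

instantiation ext_trop :: comm_semiring_1
begin

lift_definition zero_ext_trop :: ext_trop is "(0, - \<infinity>)" by simp
lift_definition one_ext_trop :: ext_trop is "(1, 0)" by simp

lift_definition plus_ext_trop :: "ext_trop \<Rightarrow> ext_trop \<Rightarrow> ext_trop" is
  "\<lambda>(a, b) (a', b'). if b = b' then (a + a', b) else if b > b' then (a, b) else (a', b')"
  by (auto simp: nat2_add_eq_0_iff split: if_splits)

lift_definition times_ext_trop :: "ext_trop \<Rightarrow> ext_trop \<Rightarrow> ext_trop" is
  "\<lambda>(a, b) (a', b'). (a * a', b + b')"
  by (auto simp: nat2_mult_eq_0_iff)

instance
proof
  fix a b c :: ext_trop
  show "a * b * c = a * (b * c)" by transfer (auto simp: ac_simps)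
  show "a * b = b * a" by transfer (auto simp: ac_simps)
  show "1 * a = a" by transfer auto
  show "a + b + c = a + (b + c)" by transfer (auto simp: ac_simps)
  show "a + b = b + a" by transfer (auto simp: ac_simps)
  show "0 + a = a" by transfer (auto split: if_splits)
  show "0 * a = 0" by transfer auto
  show "a * 0 = 0" by transfer auto
  show "(0 :: ext_trop) \<noteq> 1" by transfer auto
  show "(a + b) * c = a * c + b * c"
    by transfer (auto simp: algebra_simps split: if_splits)
qed

end

definition circ :: "ext_trop \<Rightarrow> ext_trop" where
  "circ a = a + a"

definition T_circ :: "ext_trop set" where
  "T_circ = range circ"

definition T_vee :: "ext_trop set" where
  "T_vee = (UNIV - T_circ) \<union> {0}"

lemma T_circ_iff: "a \<in> T_circ \<longleftrightarrow> a = 0 \<or> fst (Rep_ext_trop a) = 2"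
proof -
  have "(\<exists>b. a = b + b) \<longleftrightarrow> a = 0 \<or> fst (Rep_ext_trop a) = 2"
  proof
    assume "\<exists>b. a = b + b"
    then show "a = 0 \<or> fst (Rep_ext_trop a) = 2"
      by transfer (auto simp: nat2_double)
  next
    assume "a = 0 \<or> fst (Rep_ext_trop a) = 2"
    then have "a = a + a"
      by transfer (auto simp: nat2_double)
    then show "\<exists>b. a = b + b" ..
  qed
  then show ?thesis by (auto simp: T_circ_def circ_def)
qed

lemma T_vee_iff: "a \<in> T_vee \<longleftrightarrow> a = 0 \<or> fst (Rep_ext_trop a) = 1"
proof -
  have "a = 0 \<or> fst (Rep_ext_trop a) \<noteq> 0"
    by transfer auto
  then show ?thesis
    using nat2_cases[of "fst (Rep_ext_trop a)"] nat2_distinct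
    by (auto simp: T_vee_def T_circ_iff)
qed

lemma ext_trop_unit_iff: "a dvd 1 \<longleftrightarrow> a \<in> T_vee - {0}" for a :: ext_trop
proof
  assume "a dvd 1"
  then obtain b where b: "a * b = 1" by (metis dvdE)
  then have "fst (Rep_ext_trop a) = 1"
    by transfer (auto simp: nat2_mult_eq_1_iff)
  moreover have "a \<noteq> 0" using b by auto
  ultimately show "a \<in> T_vee - {0}" by (simp add: T_vee_iff)
next
  assume "a \<in> T_vee - {0}"
  then have "a \<noteq> 0" "fst (Rep_ext_trop a) = 1" by (auto simp: T_vee_iff)
  then obtain r where r: "Rep_ext_trop a = (1, ereal r)"
    using Rep_ext_trop[of a] by (cases "Rep_ext_trop a"; cases "snd (Rep_ext_trop a)") auto
  have "Rep_ext_trop (a * Abs_ext_trop (1, ereal (- r))) = Rep_ext_trop 1"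
    using r by (simp add: times_ext_trop.rep_eq one_ext_trop.rep_eq Abs_ext_trop_inverse zero_ereal_def)
  then show "a dvd 1" by (metis Rep_ext_trop_inject dvdI)
qed

definition balance :: "ext_trop \<Rightarrow> ext_trop \<Rightarrow> bool" (infix \<open>\<nabla>\<close> 50) where
  "a \<nabla> b \<longleftrightarrow> a + b \<in> T_circ"

definition balance_vec :: "ext_trop vec \<Rightarrow> ext_trop vec \<Rightarrow> bool" (infix \<open>\<nabla>\<^sub>v\<close> 50) where
  "v \<nabla>\<^sub>v w \<longleftrightarrow> dim_vec v = dim_vec w \<and> (\<forall>i < dim_vec v. v $ i \<nabla> w $ i)"

definition trop_lin_dep_cols :: "ext_trop mat \<Rightarrow> bool" where
  "trop_lin_dep_cols A \<longleftrightarrow>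
    (\<exists>x \<in> carrier_vec (dim_col A).
      (\<forall>j < dim_col A. x $ j \<in> T_vee) \<and> x \<noteq> 0\<^sub>v (dim_col A) \<and>
      A *\<^sub>v x \<nabla>\<^sub>v 0\<^sub>v (dim_row A))"

abbreviation trop_lin_indep_cols :: "ext_trop mat \<Rightarrow> bool" where
  "trop_lin_indep_cols A \<equiv> \<not> trop_lin_dep_cols A"

definition permanent :: "'a :: comm_semiring_1 mat \<Rightarrow> 'a" where
  "permanent F = (\<Sum>\<sigma> | \<sigma> permutes {0..<dim_row F}. \<Prod>i = 0..<dim_row F. F $$ (i, \<sigma> i))"

definition trop_nonsingular :: "ext_trop mat \<Rightarrow> bool" where
  "trop_nonsingular F \<longleftrightarrow> square_mat F \<and> permanent F dvd 1"

end

theory Submission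
  imports Defs "HOL-Combinatorics.Cycles"
begin

text \<open>
  A sum in the extended tropical semiring is a unit iff one summand is a unit and lies strictly
  above all other nonzero summands (\<open>sum_unit_iff\<close>). Read through this criterion, both sides of
  the equivalence become statements about real numbers.

  A vector \<open>x\<close> with \<open>A x \<nabla> 0\<close> becomes a nonempty set \<open>P\<close> of columns (its support) with a potential
  \<open>y\<close> on \<open>P\<close> (its levels) such that, for each column \<open>j\<close> in \<open>P\<close> and each row \<open>i\<close> in which the entry
  of column \<open>j\<close> is a unit, another column \<open>k\<close> of \<open>P\<close> has a nonzero entry in row \<open>i\<close> and
  \<open>a i j + y j \<le> a i k + y k\<close>. A nonsingular \<open>n \<times> n\<close> submatrix becomes an injective choice \<open>\<pi>\<close> of one
  row per column, with unit entries at \<open>(\<pi> j, j)\<close>, for which \<open>j \<mapsto> j\<close> is the only optimal assignment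
  of columns to the chosen rows.

  The heart of the proof is to pass from all rows to one row per column. Let every column \<open>j\<close> have
  a set \<open>R j\<close> of rows that it must respect. If \<open>R j\<close> is split into two parts and each of the two
  smaller problems has a solution, then so does the original one: either one of the two solutions
  avoids \<open>j\<close>, or both can be shifted to agree at \<open>j\<close>, and their pointwise maximum is a solution
  (\<open>balances_max\<close>). By induction on the number of constraints, a problem without a solution contains
  a choice \<open>\<pi>\<close> of one row per column that already has no solution (\<open>unbalanceable_choice\<close>). This
  elementary step takes the place of the existence of optimal positional strategies in the
  associated mean payoff game.

  For a single choice \<open>\<pi>\<close>, a solution exists iff \<open>\<pi>\<close> is not a strict assignment. If \<open>\<pi>\<close> uses a row
  for two columns, these two columns form a solution. If some permutation \<open>\<sigma>\<close> other than the
  identity is at least as good as the identity, the edges \<open>j \<mapsto> \<sigma> j\<close>, weighted by the gain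
  \<open>a (\<pi> j) (\<sigma> j) - a (\<pi> j) j\<close>, have nonnegative total weight, so some cycle of \<open>\<sigma>\<close> carries a potential
  (\<open>permutation_potential\<close>). Conversely a solution sends every column of \<open>P\<close> to a different column of
  \<open>P\<close>; on a minimal closed subset this map is a permutation, and it loses nothing against the
  identity because the potential cancels (\<open>strict_assignment_imp_not_balanceable\<close>).
\<close>
section \<open>Balancing potentials\<close>

text \<open>
  Here \<open>E i j\<close> says that the entry in row \<open>i\<close> and column \<open>j\<close> is nonzero, and \<open>a i j\<close> is its level. The
  set \<open>P\<close> with \<open>y\<close> encodes a tangible vector: the support is kept apart from the levels so that no
  arithmetic with minus infinity arises. The set \<open>R j\<close> is meant to contain the rows in which the
  entry of column \<open>j\<close> is a unit; it is a parameter because the proof thins it out.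
\<close>
definition balances ::
  "('r \<Rightarrow> 'c \<Rightarrow> bool) \<Rightarrow> ('r \<Rightarrow> 'c \<Rightarrow> real) \<Rightarrow> ('c \<Rightarrow> 'r set) \<Rightarrow> 'c set \<Rightarrow> ('c \<Rightarrow> real) \<Rightarrow> bool"
  where "balances E a R P y \<longleftrightarrow>
    (\<forall>j\<in>P. \<forall>i\<in>R j. \<exists>k\<in>P. k \<noteq> j \<and> E i k \<and> a i j + y j \<le> a i k + y k)"

definition balanceable ::
  "('r \<Rightarrow> 'c \<Rightarrow> bool) \<Rightarrow> ('r \<Rightarrow> 'c \<Rightarrow> real) \<Rightarrow> 'c set \<Rightarrow> ('c \<Rightarrow> 'r set) \<Rightarrow> bool"
  where "balanceable E a C R \<longleftrightarrow> (\<exists>P y. P \<subseteq> C \<and> P \<noteq> {} \<and> balances E a R P y)"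

lemma balancesI:
  assumes "\<And>j i. j \<in> P \<Longrightarrow> i \<in> R j \<Longrightarrow> \<exists>k\<in>P. k \<noteq> j \<and> E i k \<and> a i j + y j \<le> a i k + y k"
  shows "balances E a R P y"
  using assms unfolding balances_def by blast

lemma balancesE:
  assumes "balances E a R P y" "j \<in> P" "i \<in> R j"
  obtains k where "k \<in> P" "k \<noteq> j" "E i k" "a i j + y j \<le> a i k + y k"
  using assms unfolding balances_def by blast

lemma balanceableI: "P \<subseteq> C \<Longrightarrow> P \<noteq> {} \<Longrightarrow> balances E a R P y \<Longrightarrow> balanceable E a C R"
  unfolding balanceable_def by blast

lemma balances_shift:
  "balances E a R P y \<Longrightarrow> balances E a R P (\<lambda>k. y k + c)"
  unfolding balances_def by (simp add: algebra_simps)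

lemma balances_antimono:
  assumes "balances E a R P y" "\<And>j. j \<in> P \<Longrightarrow> R' j \<subseteq> R j"
  shows "balances E a R' P y"
  using assms unfolding balances_def by blast

lemma balanceable_antimono:
  assumes "balanceable E a C R" "\<And>j. j \<in> C \<Longrightarrow> R' j \<subseteq> R j"
  shows "balanceable E a C R'"
  using assms balances_antimono unfolding balanceable_def by (metis subsetD)

text \<open>
  Raising the potential on the right-hand side of an inequality keeps it true, so the maximum
  satisfies all constraints that a column has in the system whose potential attains the maximum
  there. At a column \<open>k \<noteq> j\<close> this may be either system, so only common constraints survive. At \<open>j\<close>
  both potentials attain the maximum, and the constraints of both systems survive.
\<close>
lemma balances_max:
  assumes 1: "balances E a R P y" and 2: "balances E a R' P' y'"
    and j: "j \<in> P" "j \<in> P'" "y j = y' j"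
    and R: "\<And>k. k \<noteq> j \<Longrightarrow> S k \<subseteq> R k \<inter> R' k" "S j \<subseteq> R j \<union> R' j"
  shows "balances E a S (P \<union> P')
    (\<lambda>k. if k \<in> P then if k \<in> P' then max (y k) (y' k) else y k else y' k)"
    (is "balances E a S _ ?z")
proof (rule balancesI)
  fix k i
  assume k: "k \<in> P \<union> P'" and i: "i \<in> S k"
  have ge: "l \<in> P \<Longrightarrow> y l \<le> ?z l" "l \<in> P' \<Longrightarrow> y' l \<le> ?z l" for l
    by auto
  have "k \<in> P \<and> i \<in> R k \<and> ?z k = y k \<or> k \<in> P' \<and> i \<in> R' k \<and> ?z k = y' k"
    using k i j R(1)[of k] R(2) by (cases "k = j") (auto simp: max_def)
  then show "\<exists>l\<in>P \<union> P'. l \<noteq> k \<and> E i l \<and> a i k + ?z k \<le> a i l + ?z l"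
  proof
    assume *: "k \<in> P \<and> i \<in> R k \<and> ?z k = y k"
    with 1 obtain l where "l \<in> P" "l \<noteq> k" "E i l" "a i k + y k \<le> a i l + y l"
      by (meson balancesE)
    with * ge(1)[of l] show ?thesis
      by (intro bexI[of _ l]) (auto simp del: max.bounded_iff)
  next
    assume *: "k \<in> P' \<and> i \<in> R' k \<and> ?z k = y' k"
    with 2 obtain l where "l \<in> P'" "l \<noteq> k" "E i l" "a i k + y' k \<le> a i l + y' l"
      by (meson balancesE)
    with * ge(2)[of l] show ?thesis
      by (intro bexI[of _ l]) (auto simp del: max.bounded_iff)
  qed
qed

lemma balanceable_split:
  assumes 1: "balanceable E a C (R(j := S))" and 2: "balanceable E a C (R(j := S'))"
    and R: "R j \<subseteq> S \<union> S'"
  shows "balanceable E a C R"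
proof -
  obtain P y where P: "P \<subseteq> C" "P \<noteq> {}" and y: "balances E a (R(j := S)) P y"
    using 1 unfolding balanceable_def by blast
  obtain P' y' where P': "P' \<subseteq> C" "P' \<noteq> {}" and y': "balances E a (R(j := S')) P' y'"
    using 2 unfolding balanceable_def by blast
  consider "j \<notin> P" | "j \<notin> P'" | "j \<in> P" "j \<in> P'" by blast
  then show ?thesis
  proof cases
    case 1
    then have "balances E a R P y"
      by (intro balances_antimono[OF y]) auto
    with P show ?thesis by (rule balanceableI)
  next
    case 2
    then have "balances E a R P' y'"
      by (intro balances_antimono[OF y']) auto
    with P' show ?thesis by (rule balanceableI)
  next
    case 3
    \<comment> \<open>Shifting \<open>y'\<close> by \<open>y j - y' j\<close> makes the two potentials agree at \<open>j\<close>.\<close>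
    have "balances E a R (P \<union> P') (\<lambda>k. if k \<in> P then
        if k \<in> P' then max (y k) (y' k + (y j - y' j)) else y k else y' k + (y j - y' j))"
      using 3 R by (intro balances_max[OF y balances_shift[OF y'], of j]) auto
    then show ?thesis using P P' by (intro balanceableI) auto
  qed
qed

text \<open>
  Contrapositive of \<open>balanceable_split\<close>, iterated: as long as a column has two constraints, one of the
  two parts of its constraint set keeps the problem unsolvable. A column without constraints would
  by itself form the support of a solution.
\<close>
lemma unbalanceable_choice:
  assumes "finite C" "\<And>j. j \<in> C \<Longrightarrow> finite (R j)" "\<not> balanceable E a C R"
  shows "\<exists>\<pi>. (\<forall>j\<in>C. \<pi> j \<in> R j) \<and> \<not> balanceable E a C (\<lambda>j. {\<pi> j})"
  using assms(2,3)
proof (induction "\<Sum>j\<in>C. card (R j)" arbitrary: R rule: less_induct)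
  case less
  show ?case
  proof (cases "\<forall>j\<in>C. \<exists>i. R j = {i}")
    case True
    then obtain \<pi> where \<pi>: "\<And>j. j \<in> C \<Longrightarrow> R j = {\<pi> j}" by metis
    then have "\<not> balanceable E a C (\<lambda>j. {\<pi> j})"
      using less.prems(2) balanceable_antimono[of E a C "\<lambda>j. {\<pi> j}" R] by auto
    with \<pi> show ?thesis by blast
  next
    case False
    then obtain j where j: "j \<in> C" "\<nexists>i. R j = {i}" by blast
    have "R j \<noteq> {}"
    proof
      assume "R j = {}"
      then have "balances E a R {j} (\<lambda>_. 0)" by (intro balancesI) auto
      from balanceableI[OF _ _ this, of C] j(1) less.prems(2) show False by simp
    qed
    then obtain i where i: "i \<in> R j" by blast
    have smaller: "(\<Sum>k\<in>C. card ((R(j := S)) k)) < (\<Sum>k\<in>C. card (R k))" if "S \<subset> R j" for S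
    proof (rule sum_strict_mono_ex1[OF assms(1)])
      show "\<forall>k\<in>C. card ((R(j := S)) k) \<le> card (R k)"
        using that less.prems(1) j(1) by (auto intro: card_mono)
      show "\<exists>k\<in>C. card ((R(j := S)) k) < card (R k)"
        using that less.prems(1) j(1) by (auto intro: psubset_card_mono)
    qed
    have part: ?thesis if S: "S \<subset> R j" and "\<not> balanceable E a C (R(j := S))" for S
    proof -
      have "finite ((R(j := S)) k)" if "k \<in> C" for k
        using less.prems(1) S that by (auto intro: finite_subset)
      from less.hyps[OF smaller[OF S] this that(2)]
      obtain \<pi> where "\<forall>k\<in>C. \<pi> k \<in> (R(j := S)) k" "\<not> balanceable E a C (\<lambda>j. {\<pi> j})"
        by blast
      moreover have "(R(j := S)) k \<subseteq> R k" for k using S by auto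
      ultimately show ?thesis by blast
    qed
    have "\<not> balanceable E a C (R(j := {i})) \<or> \<not> balanceable E a C (R(j := R j - {i}))"
      using less.prems(2) balanceable_split[of E a C R j "{i}" "R j - {i}"] by auto
    moreover have "{i} \<subset> R j" "R j - {i} \<subset> R j" using i j(2) by auto
    ultimately show ?thesis using part by blast
  qed
qed

section \<open>One row per column\<close>

text \<open>
  Some cycle of \<open>\<sigma>\<close> with at least two elements has nonnegative weight, because the total weight is
  nonnegative and fixed points contribute nothing. Instead of cutting such a cycle open, the proof
  averages over walks of all lengths: with \<open>\<sigma>\<^sup>N = id\<close> and \<open>S t j\<close> the weight of the first \<open>t\<close> steps from
  \<open>j\<close>, the mean \<open>y j\<close> of \<open>S 1 j, \<dots>, S N j\<close> satisfies \<open>w j + y (\<sigma> j) = y j + S N j / N\<close>, and \<open>S N\<close> is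
  constant along cycles.
\<close>
lemma permutation_potential:
  fixes w :: "'c \<Rightarrow> real"
  assumes C: "finite C" and \<sigma>: "\<sigma> permutes C" "\<sigma> \<noteq> id"
    and fixed: "\<And>j. \<sigma> j = j \<Longrightarrow> w j = 0" and nonneg: "0 \<le> sum w C"
  obtains Q y where "Q \<subseteq> C" "Q \<noteq> {}"
    "\<And>j. j \<in> Q \<Longrightarrow> \<sigma> j \<in> Q \<and> \<sigma> j \<noteq> j \<and> y j \<le> w j + y (\<sigma> j)"
proof -
  have inj: "inj \<sigma>" using \<sigma>(1) by (rule permutes_inj)
  have "permutation \<sigma>" using C \<sigma>(1) by (auto simp: permutation_permutes)
  then obtain N where N: "\<sigma> ^^ N = id" "N > 0" by (rule permutation_is_nilpotent)
  define S where "S t j = (\<Sum>s<t. w ((\<sigma> ^^ s) j))" for t j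
  have S_Suc: "S (Suc t) j = w j + S t (\<sigma> j)" for t j
    unfolding S_def by (subst sum.lessThan_Suc_shift) (simp add: funpow_swap1)
  have S_N: "S (Suc N) j = S N j + w j" for j
    unfolding S_def using N(1) by simp
  have S_inv: "S N (\<sigma> j) = S N j" for j
    using S_Suc[of N j] S_N[of j] by simp
  have S_fix: "S t j = 0" if "\<sigma> j = j" for t j
  proof -
    have "(\<sigma> ^^ s) j = j" for s using that by (induction s) auto
    then show ?thesis using fixed[OF that] by (simp add: S_def)
  qed
  \<comment> \<open>Each power of \<open>\<sigma>\<close> permutes \<open>C\<close>, so the closed walks together have \<open>N\<close> times the total weight.\<close>
  have "(\<Sum>j\<in>C. S N j) = (\<Sum>s<N. \<Sum>j\<in>C. w ((\<sigma> ^^ s) j))"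
    unfolding S_def by (rule sum.swap)
  also have "\<dots> = (\<Sum>s<N. sum w C)"
    using sum.permute[OF permutes_funpow[OF \<sigma>(1)], of w] by (simp add: comp_def)
  finally have total: "0 \<le> (\<Sum>j\<in>C. S N j)" using nonneg by simp
  define Q where "Q = {j \<in> C. \<sigma> j \<noteq> j \<and> 0 \<le> S N j}"
  define y where "y j = (\<Sum>t<N. S (Suc t) j) / N" for j
  show thesis
  proof (rule that)
    show "Q \<subseteq> C" by (auto simp: Q_def)
    show "Q \<noteq> {}"
    proof
      assume "Q = {}"
      then have neg: "S N j < 0" if "j \<in> C" "\<sigma> j \<noteq> j" for j
        using that by (force simp: Q_def)
      obtain j where "\<sigma> j \<noteq> j" using \<sigma>(2) by (auto simp: fun_eq_iff)
      moreover from this have "j \<in> C" using \<sigma>(1) by (meson permutes_not_in)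
      ultimately have "(\<Sum>j\<in>C. S N j) < (\<Sum>j\<in>C. 0)"
        using neg S_fix by (intro sum_strict_mono_ex1[OF C]) (force simp: less_le)+
      with total show False by simp
    qed
    fix j assume j: "j \<in> Q"
    have "(\<Sum>t<N. S (Suc t) (\<sigma> j)) + N * w j = (\<Sum>t<N. S (Suc (Suc t)) j)"
      by (simp add: S_Suc[of "Suc _" j] sum.distrib)
    also have "\<dots> = (\<Sum>t<N. S (Suc t) j) + (S (Suc N) j - S 1 j)"
      using sum.lessThan_Suc_shift[of "\<lambda>t. S (Suc t) j" N] by simp
    also have "\<dots> = (\<Sum>t<N. S (Suc t) j) + S N j"
      by (simp add: S_N) (simp add: S_def)
    finally have "y j \<le> w j + y (\<sigma> j)"
      using j N(2) by (simp add: y_def Q_def field_simps)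
    moreover have "\<sigma> (\<sigma> j) \<noteq> \<sigma> j" using j inj by (auto simp: Q_def dest: injD)
    ultimately show "\<sigma> j \<in> Q \<and> \<sigma> j \<noteq> j \<and> y j \<le> w j + y (\<sigma> j)"
      using j permutes_in_image[OF \<sigma>(1)] by (auto simp: Q_def S_inv)
  qed
qed

text \<open>
  The matrix with rows \<open>\<pi> j\<close> has the identity as its only optimal permutation, where permutations
  through a zero entry do not compete.
\<close>
definition strict_assignment ::
  "('r \<Rightarrow> 'c \<Rightarrow> bool) \<Rightarrow> ('r \<Rightarrow> 'c \<Rightarrow> real) \<Rightarrow> 'c set \<Rightarrow> ('c \<Rightarrow> 'r) \<Rightarrow> bool"
  where "strict_assignment E a C \<pi> \<longleftrightarrow> inj_on \<pi> C \<and>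
    (\<forall>\<sigma>. \<sigma> permutes C \<longrightarrow> \<sigma> \<noteq> id \<longrightarrow> (\<forall>j\<in>C. E (\<pi> j) (\<sigma> j)) \<longrightarrow>
      (\<Sum>j\<in>C. a (\<pi> j) (\<sigma> j)) < (\<Sum>j\<in>C. a (\<pi> j) j))"

text \<open>
  Each failure of strictness produces a solution: two columns with a common row balance each other
  in that row, and a competing permutation yields the potential of \<open>permutation_potential\<close>.
\<close>
lemma not_balanceable_imp_strict_assignment:
  assumes C: "finite C" and E: "\<And>j. j \<in> C \<Longrightarrow> E (\<pi> j) j"
    and "\<not> balanceable E a C (\<lambda>j. {\<pi> j})"
  shows "strict_assignment E a C \<pi>"
  unfolding strict_assignment_def
proof (intro conjI allI impI)
  show "inj_on \<pi> C"
  proof (rule inj_onI, rule ccontr)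
    fix j k assume jk: "j \<in> C" "k \<in> C" "\<pi> j = \<pi> k" "j \<noteq> k"
    \<comment> \<open>This potential makes both columns contribute \<open>0\<close> to their common row.\<close>
    have "balances E a (\<lambda>j. {\<pi> j}) {j, k} (\<lambda>l. - a (\<pi> j) l)"
      using jk E[of j] E[of k] by (intro balancesI) auto
    from balanceableI[OF _ _ this, of C] jk(1,2) assms(3) show False by simp
  qed
  fix \<sigma> assume \<sigma>: "\<sigma> permutes C" "\<sigma> \<noteq> id" and E\<sigma>: "\<forall>j\<in>C. E (\<pi> j) (\<sigma> j)"
  show "(\<Sum>j\<in>C. a (\<pi> j) (\<sigma> j)) < (\<Sum>j\<in>C. a (\<pi> j) j)"
  proof (rule ccontr)
    assume "\<not> ?thesis"
    then have "0 \<le> (\<Sum>j\<in>C. a (\<pi> j) (\<sigma> j) - a (\<pi> j) j)"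
      by (simp add: sum_subtractf)
    then obtain Q y where Q: "Q \<subseteq> C" "Q \<noteq> {}" and y: "\<And>j. j \<in> Q \<Longrightarrow>
        \<sigma> j \<in> Q \<and> \<sigma> j \<noteq> j \<and> y j \<le> a (\<pi> j) (\<sigma> j) - a (\<pi> j) j + y (\<sigma> j)"
      by (rule permutation_potential[OF C \<sigma>, rotated]) auto
    have "balances E a (\<lambda>j. {\<pi> j}) Q y"
    proof (rule balancesI)
      fix j i assume "j \<in> Q" "i \<in> {\<pi> j}"
      then have "i = \<pi> j" "j \<in> C" using Q by auto
      with y[OF \<open>j \<in> Q\<close>] E\<sigma> show "\<exists>k\<in>Q. k \<noteq> j \<and> E i k \<and> a i j + y j \<le> a i k + y k"
        by (intro bexI[of _ "\<sigma> j"]) auto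
    qed
    from balanceableI[OF Q this] assms(3) show False by contradiction
  qed
qed

text \<open>
  In the row chosen for \<open>j\<close>, the partner \<open>f j\<close> of \<open>j\<close> contributes at least as much as \<open>j\<close> does. On a
  smallest nonempty set closed under \<open>f\<close> the map \<open>f\<close> is bijective, and summing the inequalities there
  makes the potential disappear, which leaves a permutation that competes with the identity.
\<close>
lemma strict_assignment_imp_not_balanceable:
  assumes C: "finite C" and E: "\<And>j. j \<in> C \<Longrightarrow> E (\<pi> j) j"
    and strict: "strict_assignment E a C \<pi>"
  shows "\<not> balanceable E a C (\<lambda>j. {\<pi> j})"
proof
  assume "balanceable E a C (\<lambda>j. {\<pi> j})"
  then obtain P y where P: "P \<subseteq> C" "P \<noteq> {}" and y: "balances E a (\<lambda>j. {\<pi> j}) P y"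
    unfolding balanceable_def by blast
  have "\<forall>j\<in>P. \<exists>k. k \<in> P \<and> k \<noteq> j \<and> E (\<pi> j) k \<and> a (\<pi> j) j + y j \<le> a (\<pi> j) k + y k"
    using y unfolding balances_def by blast
  from bchoice[OF this] obtain f where f: "\<And>j. j \<in> P \<Longrightarrow>
      f j \<in> P \<and> f j \<noteq> j \<and> E (\<pi> j) (f j) \<and> a (\<pi> j) j + y j \<le> a (\<pi> j) (f j) + y (f j)"
    by blast
  define closed where "closed Q \<longleftrightarrow> Q \<subseteq> P \<and> Q \<noteq> {} \<and> f ` Q \<subseteq> Q" for Q
  have "closed P" using P f by (auto simp: closed_def)
  then obtain Q where "closed Q" and least: "\<And>Q'. closed Q' \<Longrightarrow> card Q \<le> card Q'"
    using ex_has_least_nat[of closed P card] by blast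
  then have Q: "Q \<subseteq> P" "Q \<noteq> {}" "f ` Q \<subseteq> Q" by (simp_all add: closed_def)
  have QC: "Q \<subseteq> C" using P Q by blast
  then have finQ: "finite Q" using C by (rule finite_subset)
  have "closed (f ` Q)" using Q by (auto simp: closed_def)
  then have fQ: "f ` Q = Q" by (intro card_seteq[OF finQ Q(3)] least)
  then have inj: "inj_on f Q" using finQ by (simp add: eq_card_imp_inj_on)
  define \<sigma> where "\<sigma> j = (if j \<in> Q then f j else j)" for j
  have "bij_betw \<sigma> Q Q"
    using inj fQ bij_betw_cong[of Q \<sigma> f Q] by (simp add: bij_betw_def \<sigma>_def)
  then have "\<sigma> permutes Q" by (rule bij_imp_permutes) (simp add: \<sigma>_def)
  then have "\<sigma> permutes C" using QC by (rule permutes_subset)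
  moreover have "\<sigma> \<noteq> id"
  proof -
    obtain j where "j \<in> Q" using Q by blast
    then have "\<sigma> j \<noteq> j" using f Q by (auto simp: \<sigma>_def)
    then show ?thesis by auto
  qed
  moreover have "\<forall>j\<in>C. E (\<pi> j) (\<sigma> j)" using f Q E by (auto simp: \<sigma>_def)
  ultimately have "(\<Sum>j\<in>C. a (\<pi> j) (\<sigma> j)) < (\<Sum>j\<in>C. a (\<pi> j) j)"
    using strict unfolding strict_assignment_def by blast
  moreover have "(\<Sum>j\<in>C. a (\<pi> j) j + y j) \<le> (\<Sum>j\<in>C. a (\<pi> j) (\<sigma> j) + y (\<sigma> j))"
    using f Q by (intro sum_mono) (auto simp: \<sigma>_def)
  moreover have "(\<Sum>j\<in>C. y (\<sigma> j)) = (\<Sum>j\<in>C. y j)"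
    using sum.permute[OF \<open>\<sigma> permutes C\<close>, of y] by (simp add: comp_def)
  ultimately show False by (simp add: sum.distrib)
qed

text \<open>
  A theorem of the alternative: if the system has no solution, then one constraint per column is
  enough to see this, and strictness of the assignment is the certificate.
\<close>
theorem not_balanceable_iff:
  assumes C: "finite C" and R: "\<And>j. j \<in> C \<Longrightarrow> finite (R j)"
    and E: "\<And>i j. j \<in> C \<Longrightarrow> i \<in> R j \<Longrightarrow> E i j"
  shows "\<not> balanceable E a C R \<longleftrightarrow>
    (\<exists>\<pi>. (\<forall>j\<in>C. \<pi> j \<in> R j) \<and> strict_assignment E a C \<pi>)"
proof
  assume *: "\<not> balanceable E a C R"
  have "\<exists>\<pi>. (\<forall>j\<in>C. \<pi> j \<in> R j) \<and> \<not> balanceable E a C (\<lambda>j. {\<pi> j})"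
    by (rule unbalanceable_choice[OF C R *])
  then obtain \<pi> where \<pi>: "\<forall>j\<in>C. \<pi> j \<in> R j" "\<not> balanceable E a C (\<lambda>j. {\<pi> j})"
    by blast
  have "strict_assignment E a C \<pi>"
    by (rule not_balanceable_imp_strict_assignment[OF C _ \<pi>(2)]) (use \<pi>(1) E in blast)
  with \<pi>(1) show "\<exists>\<pi>. (\<forall>j\<in>C. \<pi> j \<in> R j) \<and> strict_assignment E a C \<pi>" by blast
next
  assume "\<exists>\<pi>. (\<forall>j\<in>C. \<pi> j \<in> R j) \<and> strict_assignment E a C \<pi>"
  then obtain \<pi> where \<pi>: "\<forall>j\<in>C. \<pi> j \<in> R j" "strict_assignment E a C \<pi>" by blast
  have "\<not> balanceable E a C (\<lambda>j. {\<pi> j})"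
    by (rule strict_assignment_imp_not_balanceable[OF C _ \<pi>(2)]) (use \<pi>(1) E in blast)
  moreover have "balanceable E a C (\<lambda>j. {\<pi> j})" if "balanceable E a C R"
    by (rule balanceable_antimono[OF that]) (use \<pi>(1) in blast)
  ultimately show "\<not> balanceable E a C R" by blast
qed

text \<open>
  A strict assignment lists the chosen rows by columns, a permanent runs over columns by rows. With
  \<open>p\<close> an enumeration of the chosen rows and \<open>\<sigma>\<close> the optimal permutation, \<open>\<tau> = \<rho> \<circ> \<sigma>\<close> translates a
  competitor \<open>\<rho>\<close> of the identity into a competitor \<open>\<tau>\<close> of \<open>\<sigma>\<close>.
\<close>
lemma strict_assignment_reindex:
  assumes \<sigma>: "\<sigma> permutes C" and \<pi>: "\<And>i. i \<in> C \<Longrightarrow> \<pi> (\<sigma> i) = p i" and p: "inj_on p C"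
  shows "strict_assignment E a C \<pi> \<longleftrightarrow>
    (\<forall>\<tau>. \<tau> permutes C \<longrightarrow> \<tau> \<noteq> \<sigma> \<longrightarrow> (\<forall>i\<in>C. E (p i) (\<tau> i)) \<longrightarrow>
      (\<Sum>i\<in>C. a (p i) (\<tau> i)) < (\<Sum>i\<in>C. a (p i) (\<sigma> i)))"
proof -
  have image: "\<sigma> ` C = C" using \<sigma> by (rule permutes_image)
  have "inj_on (\<pi> \<circ> \<sigma>) C" using p \<pi> by (simp add: inj_on_def)
  then have inj: "inj_on \<pi> C" using inj_on_imageI[of \<pi> \<sigma> C] image by simp
  have ball: "(\<forall>j\<in>C. Q (\<pi> j) j) \<longleftrightarrow> (\<forall>i\<in>C. Q (p i) (\<sigma> i))" for Q
  proof -
    have "(\<forall>j\<in>C. Q (\<pi> j) j) \<longleftrightarrow> (\<forall>j\<in>\<sigma> ` C. Q (\<pi> j) j)" by (simp only: image)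
    also have "\<dots> \<longleftrightarrow> (\<forall>i\<in>C. Q (p i) (\<sigma> i))" by (simp add: \<pi>)
    finally show ?thesis .
  qed
  have sum: "(\<Sum>j\<in>C. g (\<pi> j) j) = (\<Sum>i\<in>C. g (p i) (\<sigma> i))" for g :: "'b \<Rightarrow> 'a \<Rightarrow> real"
    using sum.permute[OF \<sigma>, of "\<lambda>j. g (\<pi> j) j"] \<pi> by simp
  have all: "(\<forall>\<rho>. \<rho> permutes C \<longrightarrow> Q (\<rho> \<circ> \<sigma>)) \<longleftrightarrow> (\<forall>\<tau>. \<tau> permutes C \<longrightarrow> Q \<tau>)" for Q
  proof (intro iffI allI impI)
    fix \<tau> assume *: "\<forall>\<rho>. \<rho> permutes C \<longrightarrow> Q (\<rho> \<circ> \<sigma>)" and "\<tau> permutes C"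
    then have "\<tau> \<circ> inv_into UNIV \<sigma> permutes C" using \<sigma> by (intro permutes_compose permutes_inv)
    with * have "Q (\<tau> \<circ> inv_into UNIV \<sigma> \<circ> \<sigma>)" by blast
    then show "Q \<tau>" using permutes_inv_o(2)[OF \<sigma>] by (simp add: comp_assoc)
  qed (use \<sigma> permutes_compose in blast)
  have id: "\<rho> \<circ> \<sigma> = \<sigma> \<longleftrightarrow> \<rho> = id" for \<rho>
  proof
    assume "\<rho> \<circ> \<sigma> = \<sigma>"
    then have "\<rho> \<circ> (\<sigma> \<circ> inv_into UNIV \<sigma>) = \<sigma> \<circ> inv_into UNIV \<sigma>" by (simp flip: comp_assoc)
    then show "\<rho> = id" by (simp add: permutes_inv_o(1)[OF \<sigma>])
  qed simp
  have "strict_assignment E a C \<pi> \<longleftrightarrow>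
    (\<forall>\<rho>. \<rho> permutes C \<longrightarrow> \<rho> \<noteq> id \<longrightarrow> (\<forall>j\<in>C. E (\<pi> j) (\<rho> j)) \<longrightarrow>
      (\<Sum>j\<in>C. a (\<pi> j) (\<rho> j)) < (\<Sum>j\<in>C. a (\<pi> j) j))"
    using inj by (simp add: strict_assignment_def)
  also have "\<dots> \<longleftrightarrow>
    (\<forall>\<rho>. \<rho> permutes C \<longrightarrow> \<rho> \<circ> \<sigma> \<noteq> \<sigma> \<longrightarrow> (\<forall>i\<in>C. E (p i) ((\<rho> \<circ> \<sigma>) i)) \<longrightarrow>
      (\<Sum>i\<in>C. a (p i) ((\<rho> \<circ> \<sigma>) i)) < (\<Sum>i\<in>C. a (p i) (\<sigma> i)))"
    by (simp only: id comp_apply ball[of "\<lambda>i j. E i (\<rho> j)" for \<rho>]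
        sum[of "\<lambda>i j. a i (\<rho> j)" for \<rho>] sum[of a])
  also have "\<dots> \<longleftrightarrow>
    (\<forall>\<tau>. \<tau> permutes C \<longrightarrow> \<tau> \<noteq> \<sigma> \<longrightarrow> (\<forall>i\<in>C. E (p i) (\<tau> i)) \<longrightarrow>
      (\<Sum>i\<in>C. a (p i) (\<tau> i)) < (\<Sum>i\<in>C. a (p i) (\<sigma> i)))"
    by (rule all)
  finally show ?thesis .
qed

section \<open>Units of the extended tropical semiring\<close>

definition layer :: "ext_trop \<Rightarrow> nat2" where
  "layer a = fst (Rep_ext_trop a)"

text \<open>
  The value at \<open>0\<close> is the default \<open>real_of_ereal (- \<infinity>) = 0\<close>; levels are compared for nonzero elements
  only.
\<close>
definition level :: "ext_trop \<Rightarrow> real" where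
  "level a = real_of_ereal (snd (Rep_ext_trop a))"

lift_definition tangible :: "real \<Rightarrow> ext_trop" is "\<lambda>r. (1, ereal r)" by simp

lemma eq_0_iff_layer: "a = 0 \<longleftrightarrow> layer a = 0"
  unfolding layer_def level_def by transfer auto

lemma is_unit_iff_layer: "a dvd 1 \<longleftrightarrow> layer a = 1"
  unfolding ext_trop_unit_iff by (auto simp: T_vee_iff layer_def zero_ext_trop.rep_eq)

lemma T_circ_iff_not_unit: "a \<in> T_circ \<longleftrightarrow> \<not> a dvd 1"
  unfolding ext_trop_unit_iff by (auto simp: T_vee_def T_circ_iff)

lemma layer_tangible [simp]: "layer (tangible r) = 1"
  unfolding layer_def level_def by transfer simp

lemma level_tangible [simp]: "level (tangible r) = r"
  unfolding layer_def level_def by transfer simp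

lemma layer_mult: "layer (a * b) = layer a * layer b"
  unfolding layer_def level_def by transfer auto

lemma level_mult: "a \<noteq> 0 \<Longrightarrow> b \<noteq> 0 \<Longrightarrow> level (a * b) = level a + level b"
  unfolding layer_def level_def by transfer (auto simp: real_of_ereal_add)

lemma mult_eq_0_iff_ext_trop: "a * b = 0 \<longleftrightarrow> a = 0 \<or> b = 0" for a b :: ext_trop
  by (simp add: eq_0_iff_layer layer_mult nat2_mult_eq_0_iff)

lemma is_unit_mult_iff_ext_trop: "a * b dvd 1 \<longleftrightarrow> a dvd 1 \<and> b dvd 1" for a b :: ext_trop
  by (simp add: is_unit_iff_layer layer_mult nat2_mult_eq_1_iff)

lemma nonzero_if_unit: "a dvd 1 \<Longrightarrow> a \<noteq> 0" for a :: ext_trop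
  by auto

lemma Rep_ext_trop_nonzero:
  assumes "a \<noteq> 0"
  shows "Rep_ext_trop a = (layer a, ereal (level a))"
  using assms Rep_ext_trop[of a]
  by (cases "Rep_ext_trop a"; cases "snd (Rep_ext_trop a)")
    (auto simp: eq_0_iff_layer layer_def level_def)

lemma add_absorb:
  assumes "b \<noteq> 0" "a \<noteq> 0 \<Longrightarrow> level a < level b"
  shows "a + b = b" "b + a = b"
proof -
  show "a + b = b"
  proof (cases "a = 0")
    case False
    then have "Rep_ext_trop (a + b) = Rep_ext_trop b"
      using assms by (simp add: plus_ext_trop.rep_eq Rep_ext_trop_nonzero[of a] Rep_ext_trop_nonzero[of b])
    then show ?thesis by (simp add: Rep_ext_trop_inject)
  qed simp
  then show "b + a = b" by (simp add: add.commute)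
qed

lemma add_same_level:
  assumes "a \<noteq> 0" "b \<noteq> 0" "level a = level b"
  shows "level (a + b) = level b" "layer (a + b) = layer a + layer b"
proof -
  have "Rep_ext_trop (a + b) = (layer a + layer b, ereal (level b))"
    using assms by (simp add: plus_ext_trop.rep_eq Rep_ext_trop_nonzero[of a] Rep_ext_trop_nonzero[of b])
  then show "level (a + b) = level b" "layer (a + b) = layer a + layer b"
    by (simp_all add: layer_def[of "a + b"] level_def[of "a + b"])
qed

lemma nat2_add_neq_1: "a \<noteq> 0 \<Longrightarrow> b \<noteq> 0 \<Longrightarrow> a + b \<noteq> 1" for a b :: nat2
  by transfer auto

lemma add_level_less_iff:
  "(a + b \<noteq> 0 \<longrightarrow> level (a + b) < c) \<longleftrightarrow>
    (a \<noteq> 0 \<longrightarrow> level a < c) \<and> (b \<noteq> 0 \<longrightarrow> level b < c)"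
proof -
  consider "a = 0" | "b = 0" | "a \<noteq> 0" "b \<noteq> 0" "level a < level b"
    | "a \<noteq> 0" "b \<noteq> 0" "level b < level a" | "a \<noteq> 0" "b \<noteq> 0" "level a = level b"
    by linarith
  then show ?thesis
  proof cases
    case 5
    then have "a + b \<noteq> 0" by (simp add: eq_0_iff_layer add_same_level nat2_add_eq_0_iff)
    with 5 show ?thesis by (simp add: add_same_level)
  qed (auto simp: add_absorb)
qed

text \<open>
  Two nonzero summands of equal level give a sum in layer \<open>2\<close>, so a unit sum has a strict winner.
  The level \<open>c\<close> of the sum is fixed on both sides so that this criterion can be iterated in
  \<open>sum_unit_level_iff\<close>, where the winner's level must be carried along.
\<close>
lemma add_unit_level_iff:
  "a + b dvd 1 \<and> level (a + b) = c \<longleftrightarrow>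
    a dvd 1 \<and> level a = c \<and> (b \<noteq> 0 \<longrightarrow> level b < c) \<or>
    b dvd 1 \<and> level b = c \<and> (a \<noteq> 0 \<longrightarrow> level a < c)"
proof -
  consider "a = 0" | "b = 0" | "a \<noteq> 0" "b \<noteq> 0" "level a < level b"
    | "a \<noteq> 0" "b \<noteq> 0" "level b < level a" | "a \<noteq> 0" "b \<noteq> 0" "level a = level b"
    by linarith
  then show ?thesis
  proof cases
    case 5
    then have "layer (a + b) \<noteq> 1" by (simp add: add_same_level eq_0_iff_layer nat2_add_neq_1)
    with 5 show ?thesis by (auto simp: is_unit_iff_layer)
  qed (auto simp: add_absorb)
qed

lemma sum_level_less_iff:
  assumes "finite K"
  shows "(sum f K \<noteq> 0 \<longrightarrow> level (sum f K) < c) \<longleftrightarrow> (\<forall>k\<in>K. f k \<noteq> 0 \<longrightarrow> level (f k) < c)"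
  using assms by (induction K) (auto simp: add_level_less_iff)

lemma sum_unit_level_iff:
  assumes "finite K"
  shows "sum f K dvd 1 \<and> level (sum f K) = c \<longleftrightarrow>
    (\<exists>j\<in>K. f j dvd 1 \<and> level (f j) = c \<and> (\<forall>k\<in>K. k \<noteq> j \<longrightarrow> f k \<noteq> 0 \<longrightarrow> level (f k) < c))"
  using assms
proof (induction K)
  case empty
  show ?case by simp
next
  case (insert x K)
  have head: "(\<forall>k\<in>insert x K. k \<noteq> x \<longrightarrow> Q k) \<longleftrightarrow> (\<forall>k\<in>K. Q k)" for Q
    using insert.hyps(2) by auto
  have tail: "(\<exists>j\<in>K. U j \<and> level (f j) = c \<and> (\<forall>k\<in>insert x K. k \<noteq> j \<longrightarrow> Q k)) \<longleftrightarrow>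
    (\<exists>j\<in>K. U j \<and> level (f j) = c \<and> (\<forall>k\<in>K. k \<noteq> j \<longrightarrow> Q k)) \<and> Q x" for U Q
  proof -
    have "(\<forall>k\<in>insert x K. k \<noteq> j \<longrightarrow> Q k) \<longleftrightarrow> (\<forall>k\<in>K. k \<noteq> j \<longrightarrow> Q k) \<and> Q x" if "j \<in> K" for j
      using that insert.hyps(2) by auto
    then have "(\<exists>j\<in>K. U j \<and> level (f j) = c \<and> (\<forall>k\<in>insert x K. k \<noteq> j \<longrightarrow> Q k)) \<longleftrightarrow>
        (\<exists>j\<in>K. U j \<and> level (f j) = c \<and> (\<forall>k\<in>K. k \<noteq> j \<longrightarrow> Q k) \<and> Q x)"
      by (intro bex_cong refl conj_cong)
    also have "\<dots> \<longleftrightarrow> (\<exists>j\<in>K. U j \<and> level (f j) = c \<and> (\<forall>k\<in>K. k \<noteq> j \<longrightarrow> Q k)) \<and> Q x"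
      by blast
    finally show ?thesis .
  qed
  show ?case
    unfolding sum.insert[OF insert.hyps] add_unit_level_iff
      sum_level_less_iff[OF insert.hyps(1)] bex_simps(5) head tail
    by (simp only: conj_assoc flip: insert.IH)
qed

text \<open>
  The bridge between the semiring and real inequalities. It is applied to a permanent, as a sum over
  permutations, and to a row of \<open>A x\<close>, as a sum over columns.
\<close>
lemma sum_unit_iff:
  assumes "finite K"
  shows "sum f K dvd 1 \<longleftrightarrow>
    (\<exists>j\<in>K. f j dvd 1 \<and> (\<forall>k\<in>K. k \<noteq> j \<longrightarrow> f k \<noteq> 0 \<longrightarrow> level (f k) < level (f j)))"
proof -
  have "sum f K dvd 1 \<longleftrightarrow> (\<exists>c. sum f K dvd 1 \<and> level (sum f K) = c)" by simp
  then show ?thesis unfolding sum_unit_level_iff[OF assms] by blast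
qed

lemma prod_unit_iff:
  fixes f :: "'b \<Rightarrow> ext_trop"
  assumes "finite K"
  shows "prod f K dvd 1 \<longleftrightarrow> (\<forall>k\<in>K. f k dvd 1)"
  using assms by (induction K) (auto simp: is_unit_mult_iff_ext_trop)

lemma prod_eq_0_iff_ext_trop:
  fixes f :: "'b \<Rightarrow> ext_trop"
  assumes "finite K"
  shows "prod f K = 0 \<longleftrightarrow> (\<exists>k\<in>K. f k = 0)"
  using assms by (induction K) (auto simp: mult_eq_0_iff_ext_trop)

lemma level_1: "level 1 = 0"
  unfolding layer_def level_def by transfer simp

lemma level_prod:
  assumes "finite K" "\<And>k. k \<in> K \<Longrightarrow> f k \<noteq> 0"
  shows "level (prod f K) = (\<Sum>k\<in>K. level (f k))"
  using assms
  by (induction K) (auto simp: level_1 level_mult prod_eq_0_iff_ext_trop)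

section \<open>Matrices\<close>

lemma permanent_unit_iff:
  assumes "F \<in> carrier_mat n n"
  shows "permanent F dvd 1 \<longleftrightarrow>
    (\<exists>\<sigma>. \<sigma> permutes {..<n} \<and> (\<forall>i\<in>{..<n}. F $$ (i, \<sigma> i) dvd 1) \<and>
      (\<forall>\<tau>. \<tau> permutes {..<n} \<longrightarrow> \<tau> \<noteq> \<sigma> \<longrightarrow> (\<forall>i\<in>{..<n}. F $$ (i, \<tau> i) \<noteq> 0) \<longrightarrow>
        (\<Sum>i<n. level (F $$ (i, \<tau> i))) < (\<Sum>i<n. level (F $$ (i, \<sigma> i)))))"
proof -
  have expand: "permanent F = (\<Sum>\<sigma> | \<sigma> permutes {..<n}. \<Prod>i<n. F $$ (i, \<sigma> i))"
    using assms by (simp add: permanent_def atLeast0LessThan)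
  have nonzero: "(\<Prod>i<n. f i) \<noteq> 0 \<longleftrightarrow> (\<forall>i\<in>{..<n}. f i \<noteq> 0)" for f :: "nat \<Rightarrow> ext_trop"
    by (simp add: prod_eq_0_iff_ext_trop)
  have fin: "finite {\<sigma>. \<sigma> permutes {..<n}}"
    by (simp add: finite_permutations)
  have "permanent F dvd 1 \<longleftrightarrow> (\<Sum>\<sigma> | \<sigma> permutes {..<n}. \<Prod>i<n. F $$ (i, \<sigma> i)) dvd 1"
    by (simp only: expand)
  also have "\<dots> \<longleftrightarrow>
    (\<exists>\<sigma>. \<sigma> permutes {..<n} \<and> (\<forall>i\<in>{..<n}. F $$ (i, \<sigma> i) dvd 1) \<and>
      (\<forall>\<tau>. \<tau> permutes {..<n} \<longrightarrow> \<tau> \<noteq> \<sigma> \<longrightarrow> (\<forall>i\<in>{..<n}. F $$ (i, \<tau> i) \<noteq> 0) \<longrightarrow>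
        level (\<Prod>i<n. F $$ (i, \<tau> i)) < level (\<Prod>i<n. F $$ (i, \<sigma> i))))"
    unfolding sum_unit_iff[OF fin] prod_unit_iff[OF finite_lessThan] nonzero
    by (simp only: Bex_def Ball_def mem_Collect_eq)
  also have "\<dots> \<longleftrightarrow>
    (\<exists>\<sigma>. \<sigma> permutes {..<n} \<and> (\<forall>i\<in>{..<n}. F $$ (i, \<sigma> i) dvd 1) \<and>
      (\<forall>\<tau>. \<tau> permutes {..<n} \<longrightarrow> \<tau> \<noteq> \<sigma> \<longrightarrow> (\<forall>i\<in>{..<n}. F $$ (i, \<tau> i) \<noteq> 0) \<longrightarrow>
        (\<Sum>i<n. level (F $$ (i, \<tau> i))) < (\<Sum>i<n. level (F $$ (i, \<sigma> i)))))"
  proof -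
    have "(level (\<Prod>i<n. F $$ (i, \<tau> i)) < level (\<Prod>i<n. F $$ (i, \<sigma> i))) =
      ((\<Sum>i<n. level (F $$ (i, \<tau> i))) < (\<Sum>i<n. level (F $$ (i, \<sigma> i))))"
      if "\<forall>i\<in>{..<n}. F $$ (i, \<sigma> i) dvd 1" "\<forall>i\<in>{..<n}. F $$ (i, \<tau> i) \<noteq> 0" for \<sigma> \<tau>
    proof -
      have "level (\<Prod>i<n. F $$ (i, \<sigma> i)) = (\<Sum>i<n. level (F $$ (i, \<sigma> i)))"
        by (rule level_prod) (use that(1) nonzero_if_unit in blast)+
      moreover have "level (\<Prod>i<n. F $$ (i, \<tau> i)) = (\<Sum>i<n. level (F $$ (i, \<tau> i)))"
        by (rule level_prod) (use that(2) in blast)+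
      ultimately show ?thesis by (simp only:)
    qed
    then show ?thesis by blast
  qed
  finally show ?thesis .
qed

lemma permanent_unit_iff_strict_assignment:
  assumes F: "F \<in> carrier_mat n n" and p: "inj_on p {..<n}"
    and FA: "\<And>i j. i < n \<Longrightarrow> j < n \<Longrightarrow> F $$ (i, j) = A $$ (p i, j)"
  shows "permanent F dvd 1 \<longleftrightarrow>
    (\<exists>\<pi>. \<pi> ` {..<n} = p ` {..<n} \<and> (\<forall>j\<in>{..<n}. A $$ (\<pi> j, j) dvd 1) \<and>
      strict_assignment (\<lambda>i j. A $$ (i, j) \<noteq> 0) (\<lambda>i j. level (A $$ (i, j))) {..<n} \<pi>)"
    (is "_ \<longleftrightarrow> (\<exists>\<pi>. ?R \<pi>)")
proof -
  have FA': "F $$ (i, \<tau> i) = A $$ (p i, \<tau> i)" if "\<tau> permutes {..<n}" "i \<in> {..<n}" for \<tau> i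
    using that FA permutes_in_image[OF that(1), of i] by simp
  define opt where "opt \<sigma> \<longleftrightarrow> (\<forall>i\<in>{..<n}. A $$ (p i, \<sigma> i) dvd 1) \<and>
    (\<forall>\<tau>. \<tau> permutes {..<n} \<longrightarrow> \<tau> \<noteq> \<sigma> \<longrightarrow> (\<forall>i\<in>{..<n}. A $$ (p i, \<tau> i) \<noteq> 0) \<longrightarrow>
      (\<Sum>i<n. level (A $$ (p i, \<tau> i))) < (\<Sum>i<n. level (A $$ (p i, \<sigma> i))))" for \<sigma>
  have "permanent F dvd 1 \<longleftrightarrow> (\<exists>\<sigma>. \<sigma> permutes {..<n} \<and> opt \<sigma>)"
    unfolding permanent_unit_iff[OF F] opt_def
    by (simp add: FA' cong: conj_cong imp_cong)
  also have "\<dots> \<longleftrightarrow> (\<exists>\<pi>. ?R \<pi>)"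
  proof -
    have R_iff: "?R \<pi> \<longleftrightarrow> opt \<sigma>"
      if \<sigma>: "\<sigma> permutes {..<n}" and \<pi>: "\<And>i. i \<in> {..<n} \<Longrightarrow> \<pi> (\<sigma> i) = p i" for \<sigma> \<pi>
    proof -
      have image: "\<sigma> ` {..<n} = {..<n}" using \<sigma> by (rule permutes_image)
      have "\<pi> ` {..<n} = p ` {..<n}"
        using image \<pi> by (metis (no_types, lifting) image_cong image_image)
      moreover have "(\<forall>j\<in>{..<n}. A $$ (\<pi> j, j) dvd 1) \<longleftrightarrow> (\<forall>i\<in>{..<n}. A $$ (p i, \<sigma> i) dvd 1)"
        using image \<pi> by (metis (no_types, opaque_lifting) imageE imageI)
      moreover have
        "strict_assignment (\<lambda>i j. A $$ (i, j) \<noteq> 0) (\<lambda>i j. level (A $$ (i, j))) {..<n} \<pi> \<longleftrightarrow>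
          (\<forall>\<tau>. \<tau> permutes {..<n} \<longrightarrow> \<tau> \<noteq> \<sigma> \<longrightarrow> (\<forall>i\<in>{..<n}. A $$ (p i, \<tau> i) \<noteq> 0) \<longrightarrow>
            (\<Sum>i<n. level (A $$ (p i, \<tau> i))) < (\<Sum>i<n. level (A $$ (p i, \<sigma> i))))"
        by (rule strict_assignment_reindex[OF \<sigma> _ p]) (rule \<pi>)
      ultimately show ?thesis unfolding opt_def by (simp only: simp_thms)
    qed
    show ?thesis
    proof
      assume "\<exists>\<sigma>. \<sigma> permutes {..<n} \<and> opt \<sigma>"
      then obtain \<sigma> where \<sigma>: "\<sigma> permutes {..<n}" "opt \<sigma>" by blast
      then have "?R (p \<circ> inv_into UNIV \<sigma>)"
        using permutes_inverses[OF \<sigma>(1)] by (subst R_iff[of \<sigma>]) auto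
      then show "\<exists>\<pi>. ?R \<pi>" by blast
    next
      assume "\<exists>\<pi>. ?R \<pi>"
      then obtain \<pi> where \<pi>: "?R \<pi>" by blast
      define \<sigma> where "\<sigma> i = (if i < n then inv_into {..<n} \<pi> (p i) else i)" for i
      have inv: "\<pi> (\<sigma> i) = p i" "\<sigma> i < n" if "i \<in> {..<n}" for i
        using that \<pi> f_inv_into_f[of "p i" \<pi> "{..<n}"] inv_into_into[of "p i" \<pi> "{..<n}"]
        by (auto simp: \<sigma>_def)
      have "inj_on \<sigma> {..<n}" using inv p by (metis inj_on_def)
      then have "bij_betw \<sigma> {..<n} {..<n}"
        using inv by (simp add: bij_betw_def endo_inj_surj image_subset_iff)
      then have "\<sigma> permutes {..<n}" by (rule bij_imp_permutes) (simp add: \<sigma>_def)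
      with inv(1) \<pi> R_iff show "\<exists>\<sigma>. \<sigma> permutes {..<n} \<and> opt \<sigma>" by blast
    qed
  qed
  finally show ?thesis .
qed

text \<open>
  With \<open>n\<close> columns available, the column set is all of \<open>{..<n}\<close>, and \<open>pick I\<close> enumerates the rows.
  The image of a strict assignment is the row set of a nonsingular submatrix.
\<close>
lemma nonsingular_submatrix_iff_strict_assignment:
  assumes A: "A \<in> carrier_mat m n"
  shows "(\<exists>I J. I \<subseteq> {..<m} \<and> J \<subseteq> {..<n} \<and> card I = n \<and> card J = n \<and>
      trop_nonsingular (submatrix A I J)) \<longleftrightarrow>
    (\<exists>\<pi>. (\<forall>j\<in>{..<n}. \<pi> j \<in> {i. i < m \<and> A $$ (i, j) dvd 1}) \<and>
      strict_assignment (\<lambda>i j. A $$ (i, j) \<noteq> 0) (\<lambda>i j. level (A $$ (i, j))) {..<n} \<pi>)"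
    (is "?L \<longleftrightarrow> (\<exists>\<pi>. ?Q \<pi>)")
proof -
  have cols: "J = {..<n}" if "J \<subseteq> {..<n}" "card J = n" for J
    using that by (simp add: card_subset_eq)
  have pick_row: "inj_on (pick I) {..<n}" "pick I ` {..<n} = I" if "card I = n" "I \<subseteq> {..<m}" for I
  proof -
    show inj: "inj_on (pick I) {..<n}"
      using pick_mono_le[of _ I] that by (intro linorder_inj_onI) (auto simp: less_le)
    have "pick I ` {..<n} \<subseteq> I" using pick_in_set_le[of _ I] that by auto
    then show "pick I ` {..<n} = I"
      using that inj by (intro card_subset_eq) (auto simp: card_image intro: finite_subset)
  qed
  have pick_col: "pick {..<n} j = j" if "j < n" for j
    using pick_reduce_set[of j n UNIV] that by (simp add: pick_UNIV lessThan_def)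
  have minor: "trop_nonsingular (submatrix A I {..<n}) \<longleftrightarrow>
      (\<exists>\<pi>. \<pi> ` {..<n} = I \<and> (\<forall>j\<in>{..<n}. A $$ (\<pi> j, j) dvd 1) \<and>
      strict_assignment (\<lambda>i j. A $$ (i, j) \<noteq> 0) (\<lambda>i j. level (A $$ (i, j))) {..<n} \<pi>)"
    if I: "I \<subseteq> {..<m}" "card I = n" for I
  proof -
    have "{i. i < m \<and> i \<in> I} = I" using I by auto
    then have dims: "card {i. i < dim_row A \<and> i \<in> I} = n"
      "card {j. j < dim_col A \<and> j \<in> {..<n}} = n"
      using A I by auto
    have F: "submatrix A I {..<n} \<in> carrier_mat n n"
      by (rule carrier_matI) (simp_all only: dim_submatrix dims)
    have entry: "submatrix A I {..<n} $$ (i, j) = A $$ (pick I i, j)" if "i < n" "j < n" for i j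
      using that dims pick_col by (simp add: submatrix_index)
    show ?thesis
      using permanent_unit_iff_strict_assignment[OF F pick_row(1)[OF I(2,1)] entry] F
      unfolding pick_row(2)[OF I(2,1)] by (simp add: trop_nonsingular_def)
  qed
  show ?thesis
  proof
    assume ?L
    then obtain I where I: "I \<subseteq> {..<m}" "card I = n" "trop_nonsingular (submatrix A I {..<n})"
      using cols by blast
    then show "\<exists>\<pi>. ?Q \<pi>" unfolding minor[OF I(1,2)] by blast
  next
    assume "\<exists>\<pi>. ?Q \<pi>"
    then obtain \<pi> where \<pi>: "?Q \<pi>" by blast
    then have "inj_on \<pi> {..<n}" by (simp add: strict_assignment_def)
    then have "card (\<pi> ` {..<n}) = n" by (simp add: card_image)
    moreover have "\<pi> ` {..<n} \<subseteq> {..<m}" using \<pi> by auto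
    ultimately show ?L
      using \<pi> minor by (intro exI[of _ "\<pi> ` {..<n}"] exI[of _ "{..<n}"]) auto
  qed
qed

text \<open>
  By \<open>sum_unit_iff\<close>, an entry of \<open>A x\<close> fails to be balanced iff a single unit term dominates it
  strictly. So the condition is that no unit term does, and such terms come from unit entries of \<open>A\<close>
  in the support of \<open>x\<close>.
\<close>
lemma row_balance_iff:
  assumes A: "A \<in> carrier_mat m n" and x: "x \<in> carrier_vec n"
    and vee: "\<forall>j<n. x $ j \<in> T_vee" and i: "i < m"
  shows "(A *\<^sub>v x) $ i \<nabla> 0 \<longleftrightarrow> (\<forall>j<n. x $ j \<noteq> 0 \<longrightarrow> A $$ (i, j) dvd 1 \<longrightarrow>
    (\<exists>k<n. x $ k \<noteq> 0 \<and> k \<noteq> j \<and> A $$ (i, k) \<noteq> 0 \<and>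
      level (A $$ (i, j)) + level (x $ j) \<le> level (A $$ (i, k)) + level (x $ k)))"
proof -
  have "(A *\<^sub>v x) $ i = (\<Sum>j<n. A $$ (i, j) * x $ j)"
    using A x i by (simp add: scalar_prod_def atLeast0LessThan)
  moreover have x_unit: "x $ j dvd 1 \<longleftrightarrow> x $ j \<noteq> 0" if "j < n" for j
    using vee that by (simp add: ext_trop_unit_iff)
  ultimately have "(A *\<^sub>v x) $ i \<nabla> 0 \<longleftrightarrow>
    \<not> (\<exists>j\<in>{..<n}. A $$ (i, j) * x $ j dvd 1 \<and> (\<forall>k\<in>{..<n}. k \<noteq> j \<longrightarrow>
      A $$ (i, k) * x $ k \<noteq> 0 \<longrightarrow> level (A $$ (i, k) * x $ k) < level (A $$ (i, j) * x $ j)))"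
    by (simp only: balance_def add_0_right T_circ_iff_not_unit sum_unit_iff[OF finite_lessThan])
  also have "\<dots> \<longleftrightarrow> (\<forall>j<n. x $ j \<noteq> 0 \<longrightarrow> A $$ (i, j) dvd 1 \<longrightarrow>
    (\<exists>k<n. x $ k \<noteq> 0 \<and> k \<noteq> j \<and> A $$ (i, k) \<noteq> 0 \<and>
      level (A $$ (i, j) * x $ j) \<le> level (A $$ (i, k) * x $ k)))"
    unfolding is_unit_mult_iff_ext_trop mult_eq_0_iff_ext_trop not_less[symmetric]
    using x_unit by blast
  also have "\<dots> \<longleftrightarrow> (\<forall>j<n. x $ j \<noteq> 0 \<longrightarrow> A $$ (i, j) dvd 1 \<longrightarrow>
    (\<exists>k<n. x $ k \<noteq> 0 \<and> k \<noteq> j \<and> A $$ (i, k) \<noteq> 0 \<and>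
      level (A $$ (i, j)) + level (x $ j) \<le> level (A $$ (i, k)) + level (x $ k)))"
  proof -
    have "(level (A $$ (i, j) * x $ j) \<le> level (A $$ (i, k) * x $ k)) =
      (level (A $$ (i, j)) + level (x $ j) \<le> level (A $$ (i, k)) + level (x $ k))"
      if "x $ j \<noteq> 0" "A $$ (i, j) dvd 1" "x $ k \<noteq> 0" "A $$ (i, k) \<noteq> 0" for j k
      using level_mult[OF nonzero_if_unit[OF that(2)] that(1)] level_mult[OF that(4,3)]
      by (simp only:)
    then show ?thesis by (smt (verit))
  qed
  finally show ?thesis .
qed

lemma trop_lin_dep_cols_iff_balanceable:
  assumes A: "A \<in> carrier_mat m n"
  shows "trop_lin_dep_cols A \<longleftrightarrow>
    balanceable (\<lambda>i j. A $$ (i, j) \<noteq> 0) (\<lambda>i j. level (A $$ (i, j))) {..<n}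
      (\<lambda>j. {i. i < m \<and> A $$ (i, j) dvd 1})"
    (is "_ \<longleftrightarrow> balanceable ?E ?a _ ?R")
proof -
  have main: "A *\<^sub>v x \<nabla>\<^sub>v 0\<^sub>v m \<longleftrightarrow> balances ?E ?a ?R {j. j < n \<and> x $ j \<noteq> 0} (\<lambda>j. level (x $ j))"
    if "x \<in> carrier_vec n" "\<forall>j<n. x $ j \<in> T_vee" for x
  proof -
    have "A *\<^sub>v x \<nabla>\<^sub>v 0\<^sub>v m \<longleftrightarrow> (\<forall>i<m. (A *\<^sub>v x) $ i \<nabla> 0)"
      using A by (simp add: balance_vec_def)
    also have "\<dots> \<longleftrightarrow> balances ?E ?a ?R {j. j < n \<and> x $ j \<noteq> 0} (\<lambda>j. level (x $ j))"
    proof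
      assume *: "\<forall>i<m. (A *\<^sub>v x) $ i \<nabla> 0"
      show "balances ?E ?a ?R {j. j < n \<and> x $ j \<noteq> 0} (\<lambda>j. level (x $ j))"
      proof (rule balancesI)
        fix j i assume "j \<in> {j. j < n \<and> x $ j \<noteq> 0}" "i \<in> ?R j"
        then have j: "j < n" "x $ j \<noteq> 0" and i: "i < m" "A $$ (i, j) dvd 1" by simp_all
        have "(A *\<^sub>v x) $ i \<nabla> 0" using * i(1) by simp
        from this[unfolded row_balance_iff[OF A that i(1)], rule_format, OF j i(2)]
        show "\<exists>k\<in>{j. j < n \<and> x $ j \<noteq> 0}. k \<noteq> j \<and> ?E i k \<and>
            ?a i j + level (x $ j) \<le> ?a i k + level (x $ k)"
          by blast
      qed
    next
      assume *: "balances ?E ?a ?R {j. j < n \<and> x $ j \<noteq> 0} (\<lambda>j. level (x $ j))"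
      show "\<forall>i<m. (A *\<^sub>v x) $ i \<nabla> 0"
      proof (intro allI impI)
        fix i assume i: "i < m"
        show "(A *\<^sub>v x) $ i \<nabla> 0"
          unfolding row_balance_iff[OF A that i]
        proof (intro allI impI)
          fix j assume "j < n" "x $ j \<noteq> 0" "A $$ (i, j) dvd 1"
          then have "j \<in> {j. j < n \<and> x $ j \<noteq> 0}" "i \<in> ?R j" using i by simp_all
          with * obtain k where "k \<in> {j. j < n \<and> x $ j \<noteq> 0}" "k \<noteq> j" "A $$ (i, k) \<noteq> 0"
            "level (A $$ (i, j)) + level (x $ j) \<le> level (A $$ (i, k)) + level (x $ k)"
            by (rule balancesE)
          then show "\<exists>k<n. x $ k \<noteq> 0 \<and> k \<noteq> j \<and> A $$ (i, k) \<noteq> 0 \<and>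
              level (A $$ (i, j)) + level (x $ j) \<le> level (A $$ (i, k)) + level (x $ k)"
            by blast
        qed
      qed
    qed
    finally show ?thesis .
  qed
  have dims: "dim_row A = m" "dim_col A = n" using A by auto
  show ?thesis
  proof
    assume "trop_lin_dep_cols A"
    then obtain x where x: "x \<in> carrier_vec n" "\<forall>j<n. x $ j \<in> T_vee"
      "x \<noteq> 0\<^sub>v n" "A *\<^sub>v x \<nabla>\<^sub>v 0\<^sub>v m"
      unfolding trop_lin_dep_cols_def dims by blast
    have "{j. j < n \<and> x $ j \<noteq> 0} \<noteq> {}" using x(1,3) by (auto simp: vec_eq_iff)
    moreover have "balances ?E ?a ?R {j. j < n \<and> x $ j \<noteq> 0} (\<lambda>j. level (x $ j))"
      using x(4) main[OF x(1,2)] by simp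
    ultimately show "balanceable ?E ?a {..<n} ?R"
      by (rule balanceableI[rotated]) blast
  next
    assume "balanceable ?E ?a {..<n} ?R"
    then obtain P y where P: "P \<subseteq> {..<n}" "P \<noteq> {}" and y: "balances ?E ?a ?R P y"
      unfolding balanceable_def by blast
    define x where "x = vec n (\<lambda>j. if j \<in> P then tangible (y j) else 0)"
    have x: "x \<in> carrier_vec n" by (simp add: x_def)
    have tangible: "tangible r \<noteq> 0" "tangible r \<in> T_vee" for r
      using ext_trop_unit_iff[of "tangible r"] unfolding is_unit_iff_layer layer_tangible by simp_all
    have vee: "\<forall>j<n. x $ j \<in> T_vee"
      using tangible by (simp add: x_def T_vee_def)
    have supp: "{j. j < n \<and> x $ j \<noteq> 0} = P"
      using P(1) tangible(1) by (auto simp: x_def split: if_splits)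
    have "level (x $ j) = y j" if "j \<in> P" for j
      using that P by (auto simp: x_def)
    then have "balances ?E ?a ?R P (\<lambda>j. level (x $ j))"
      using y by (simp add: balances_def cong: ball_cong bex_cong)
    then have "A *\<^sub>v x \<nabla>\<^sub>v 0\<^sub>v m" using main[OF x vee] supp by simp
    moreover have "x \<noteq> 0\<^sub>v n" using supp P by auto
    ultimately show "trop_lin_dep_cols A"
      unfolding trop_lin_dep_cols_def dims using x vee by blast
  qed
qed

theorem theorem4p12:
  fixes A :: "ext_trop mat" and m n :: nat
  assumes "A \<in> carrier_mat m n" and "m \<ge> n"
  shows "trop_lin_indep_cols A \<longleftrightarrow>
    (\<exists>I J. I \<subseteq> {..<m} \<and> J \<subseteq> {..<n} \<and> card I = n \<and> card J = n \<and>
      trop_nonsingular (submatrix A I J))"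
proof -
  have "trop_lin_indep_cols A \<longleftrightarrow>
    (\<exists>\<pi>. (\<forall>j\<in>{..<n}. \<pi> j \<in> {i. i < m \<and> A $$ (i, j) dvd 1}) \<and>
      strict_assignment (\<lambda>i j. A $$ (i, j) \<noteq> 0) (\<lambda>i j. level (A $$ (i, j))) {..<n} \<pi>)"
    unfolding trop_lin_dep_cols_iff_balanceable[OF assms(1)]
    by (rule not_balanceable_iff) (auto dest: nonzero_if_unit)
  then show ?thesis
    unfolding nonsingular_submatrix_iff_strict_assignment[OF assms(1)] .
qed

end
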